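(* Every weakly l.f.g.u. weakly positive monoid $\mathcal H = (H, \preceq)$ is factorable, i.e., every $\preceq$-non-unit of $H$ is a product of $\preceq$-irreducibles.
   Context: A premonoid is a pair $\mathcal H = (H, \preceq)$ consisting of a (multiplicatively written) monoid $H$ with identity $1_H$ and a preorder (reflexive, transitive relation) $\preceq$ on $H$. Write $x \prec y$ if $x \preceq y$ and $y \not\preceq x$. An element $u \in H$ is a $\preceq$-unit if $u \preceq 1_H \preceq u$ and a $\preceq$-non-unit otherwise; $\mathcal H^\times$ is the set of $\preceq$-units. A $\preceq$-irreducible is a $\preceq$-non-unit $a \in H$ such that $a \neq xy$ for all $\preceq$-non-units $x, y \in H$ with $x \prec a$ and $y \prec a$. $\mathcal H$ is a weakly positive monoid if, for every $x \in H$, one has $uxv \preceq x$ for all $u, v \in \mathcal H^\times$ and $x \preceq yxz$ for all $y, z \in H$. For $X \subseteq H$, $\langle X \rangle_H$ is the submonoid generated by $X$. A subpremonoid of $\mathcal H$ is a premonoid $(K,\preceq_K)$ with $K$ a submonoid of $H$ and $\preceq_K$ the restriction of $\preceq$ to $K$. A divisor of $x$ in $H$ is an element $y \in H$ with $x \in HyH$. The germ of $\mathcal H$ at $x \in H$ is the subpremonoid of $\mathcal H$ whose underlying monoid is the submonoid of $H$ generated by all divisors of $x$ in $H$. A premonoid $\mathcal K = (K, \preceq_K)$ is f.g.u. if $K = \langle \mathcal K^\times A\, \mathcal K^\times \rangle_K$ for some finite $A \subseteq K$, where $\mathcal K^\times$ is the set of $\preceq_K$-units of $K$. $\mathcal H$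 is weakly l.f.g.u. if its germ at every $\preceq$-non-unit is an f.g.u. premonoid. *)

theory Defs
  imports "HOL.Hull" "HOL-Algebra.Coset"
begin

record 'a premonoid = "'a monoid" +
  preord :: "['a, 'a] \<Rightarrow> bool"  (infix \<open>\<preceq>\<index>\<close> 50)

locale premonoid = monoid H for H (structure) +
  assumes preord_refl: "reflp_on (carrier H) (\<preceq>)"
    and preord_trans: "transp_on (carrier H) (\<preceq>)"

definition preord_strict :: "[('a, 'b) premonoid_scheme, 'a, 'a] \<Rightarrow> bool"
    (\<open>(\<open>open_block notation=\<open>infix preord_strict\<close>\<close>_/ \<prec>\<index> _)\<close> [51, 51] 50)
  where "x \<prec>\<^bsub>H\<^esub> y \<longleftrightarrow> x \<preceq>\<^bsub>H\<^esub> y \<and> \<not> y \<preceq>\<^bsub>H\<^esub> x"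

text \<open>Units and irreducibles are taken with respect to the preorder; they are not the
  \<^const>\<open>Units\<close> of the underlying monoid.\<close>

definition pre_units :: "('a, 'b) premonoid_scheme \<Rightarrow> 'a set"
  where "pre_units H = {u \<in> carrier H. u \<preceq>\<^bsub>H\<^esub> \<one>\<^bsub>H\<^esub> \<and> \<one>\<^bsub>H\<^esub> \<preceq>\<^bsub>H\<^esub> u}"

definition pre_nonunits :: "('a, 'b) premonoid_scheme \<Rightarrow> 'a set"
  where "pre_nonunits H = carrier H - pre_units H"

definition pre_irreducible :: "[('a, 'b) premonoid_scheme, 'a] \<Rightarrow> bool"
  where "pre_irreducible H a \<longleftrightarrow> a \<in> pre_nonunits H \<and>
    (\<forall>x \<in> pre_nonunits H. \<forall>y \<in> pre_nonunits H.
       x \<prec>\<^bsub>H\<^esub> a \<longrightarrow> y \<prec>\<^bsub>H\<^esub> a \<longrightarrow> a \<noteq> x \<otimes>\<^bsub>H\<^esub> y)"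

locale weakly_positive_monoid = premonoid +
  assumes units_le: "\<lbrakk>x \<in> carrier H; u \<in> pre_units H; v \<in> pre_units H\<rbrakk> \<Longrightarrow> u \<otimes> x \<otimes> v \<preceq> x"
    and le_mult: "\<lbrakk>x \<in> carrier H; y \<in> carrier H; z \<in> carrier H\<rbrakk> \<Longrightarrow> x \<preceq> y \<otimes> x \<otimes> z"

text \<open>The intersection of all submonoids containing \<open>X\<close>; meaningful for
  \<open>X \<subseteq> carrier H\<close>.\<close>

definition generated_submonoid :: "('a, 'b) monoid_scheme \<Rightarrow> 'a set \<Rightarrow> 'a set"
  where "generated_submonoid H X = (\<lambda>K. submonoid K H) hull X"

definition subpremonoid :: "('a, 'b) premonoid_scheme \<Rightarrow> 'a set \<Rightarrow> ('a, 'b) premonoid_scheme"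
  where "subpremonoid H K =
    H\<lparr>carrier := K, preord := (\<lambda>x y. x \<in> K \<and> y \<in> K \<and> x \<preceq>\<^bsub>H\<^esub> y)\<rparr>"

definition divisors :: "('a, 'b) monoid_scheme \<Rightarrow> 'a \<Rightarrow> 'a set"
  where "divisors H x = {y \<in> carrier H. x \<in> carrier H <#>\<^bsub>H\<^esub> {y} <#>\<^bsub>H\<^esub> carrier H}"

definition germ :: "('a, 'b) premonoid_scheme \<Rightarrow> 'a \<Rightarrow> ('a, 'b) premonoid_scheme"
  where "germ H x = subpremonoid H (generated_submonoid H (divisors H x))"

definition fgu :: "('a, 'b) premonoid_scheme \<Rightarrow> bool"
  where "fgu K \<longleftrightarrow> (\<exists>A \<subseteq> carrier K. finite A \<and>
    carrier K = generated_submonoid K (pre_units K <#>\<^bsub>K\<^esub> A <#>\<^bsub>K\<^esub> pre_units K))"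

definition weakly_lfgu :: "('a, 'b) premonoid_scheme \<Rightarrow> bool"
  where "weakly_lfgu H \<longleftrightarrow> (\<forall>x \<in> pre_nonunits H. fgu (germ H x))"

text \<open>A product is the product of a list of factors. The empty list is harmless here: its
  product \<open>\<one>\<close> is never a non-unit, by reflexivity.\<close>

definition factorable :: "('a, 'b) premonoid_scheme \<Rightarrow> bool"
  where "factorable H \<longleftrightarrow> (\<forall>x \<in> pre_nonunits H.
    \<exists>as. (\<forall>a \<in> set as. pre_irreducible H a) \<and> x = foldr (\<otimes>\<^bsub>H\<^esub>) as \<one>\<^bsub>H\<^esub>)"

lemma (in monoid) submonoid_generated_submonoid:
  assumes "X \<subseteq> carrier G"
  shows "submonoid (generated_submonoid G X) G"
proof -
  have "submonoid (carrier G) G"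
    by (rule submonoid.intro) auto
  then have "\<exists>K. submonoid K G \<and> X \<subseteq> K"
    using assms by blast
  then show ?thesis
    unfolding generated_submonoid_def hull_def
    by (intro submonoid.intro) (auto dest: submonoid.subset intro: submonoid.m_closed submonoid.one_closed)
qed

lemma (in premonoid) premonoid_subpremonoid:
  assumes "submonoid K H"
  shows "premonoid (subpremonoid H K)"
proof -
  interpret K: submonoid K H by fact
  have sub: "K \<subseteq> carrier H"
    by (rule K.subset)
  have "monoid (subpremonoid H K)"
    using sub by unfold_locales (auto simp: subpremonoid_def m_assoc)
  moreover have "reflp_on K (\<preceq>)" "transp_on K (\<preceq>)"
    using preord_refl preord_trans sub by (auto intro: reflp_on_subset transp_on_subset)
  ultimately show ?thesis
    by (auto simp: premonoid_def premonoid_axioms_def subpremonoid_def reflp_on_def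
        dest: transp_onD intro!: transp_onI)
qed

lemma (in premonoid) premonoid_germ: "premonoid (germ H x)"
  unfolding germ_def
  by (intro premonoid_subpremonoid submonoid_generated_submonoid) (auto simp: divisors_def)

end

theory Submission
  imports Defs
begin

text \<open>Fix a non-unit \<open>x\<close> and let \<open>K = \<langle>U A U\<rangle>\<close> be its germ, \<open>A\<close> finite. Because units are closed under
  products and divisors, each non-unit divisor of \<open>x\<close> is a nonempty product of non-units
  \<open>s = u a v\<close> in \<open>U A U\<close>, all of which divide \<open>x\<close> and are equivalent to an element of \<open>A\<close>.
  If \<open>s\<close> is not irreducible, then \<open>s = p q\<close> with non-units \<open>p, q \<prec> s\<close>, and fewer elements of \<open>A\<close>
  lie below \<open>p\<close> or \<open>q\<close> than below \<open>s\<close>, since \<open>a\<close> itself does not. Hence one can induct on the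
  number of elements of \<open>A\<close> below a divisor of \<open>x\<close>.\<close>

text \<open>Products here have at least one factor. A submonoid would contain the empty product,
  which has no factor to absorb a neighbouring unit.\<close>

inductive_set generated_subsemigroup :: "('a, 'b) monoid_scheme \<Rightarrow> 'a set \<Rightarrow> 'a set"
  for G X where
    base: "x \<in> X \<Longrightarrow> x \<in> generated_subsemigroup G X"
  | mult: "\<lbrakk>x \<in> generated_subsemigroup G X; y \<in> generated_subsemigroup G X\<rbrakk>
      \<Longrightarrow> x \<otimes>\<^bsub>G\<^esub> y \<in> generated_subsemigroup G X"

lemma generated_subsemigroup_least:
  assumes "X \<subseteq> generated_subsemigroup G Y"
  shows "generated_subsemigroup G X \<subseteq> generated_subsemigroup G Y"
proof
  fix x assume "x \<in> generated_subsemigroup G X"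
  then show "x \<in> generated_subsemigroup G Y"
    by induction (use assms in \<open>auto intro: generated_subsemigroup.mult\<close>)
qed

section \<open>Products and divisors in a monoid\<close>

context monoid
begin

lemma generated_subsemigroup_closed:
  assumes "x \<in> generated_subsemigroup G X" "X \<subseteq> carrier G"
  shows "x \<in> carrier G"
  using assms by induction auto

lemma foldr_mult_append:
  assumes "set xs \<subseteq> carrier G" "set ys \<subseteq> carrier G"
  shows "foldr (\<otimes>) (xs @ ys) \<one> = foldr (\<otimes>) xs \<one> \<otimes> foldr (\<otimes>) ys \<one>"
proof -
  have closed: "foldr (\<otimes>) zs \<one> \<in> carrier G" if "set zs \<subseteq> carrier G" for zs
    using that by (induction zs) auto
  show ?thesis
    using assms by (induction xs) (auto simp: closed m_assoc)
qed

lemma generated_subsemigroup_foldr: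
  assumes "x \<in> generated_subsemigroup G X" "X \<subseteq> carrier G"
  shows "\<exists>xs. set xs \<subseteq> X \<and> x = foldr (\<otimes>) xs \<one>"
  using assms
proof induction
  case (base x)
  then show ?case
    by (intro exI[of _ "[x]"]) auto
next
  case (mult x y)
  then obtain xs ys where "set xs \<subseteq> X" "x = foldr (\<otimes>) xs \<one>" "set ys \<subseteq> X" "y = foldr (\<otimes>) ys \<one>"
    by blast
  \<comment> \<open>\<open>foldr_append\<close> would turn the fold over \<open>xs @ ys\<close> into
    nested folds before \<open>foldr_mult_append\<close> can split it as a product.\<close>
  with mult.prems show ?case
    by (intro exI[of _ "xs @ ys"]) (simp add: foldr_mult_append del: foldr_append)
qed

lemma mem_divisors_iff:
  "y \<in> divisors G x \<longleftrightarrow> y \<in> carrier G \<and> (\<exists>p \<in> carrier G. \<exists>q \<in> carrier G. x = p \<otimes> y \<otimes> q)"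
  by (auto simp: divisors_def set_mult_def)

lemma divisors_refl: "x \<in> carrier G \<Longrightarrow> x \<in> divisors G x"
  unfolding mem_divisors_iff by (auto intro!: bexI[of _ \<one>])

lemma divisors_trans:
  assumes "z \<in> divisors G y" "y \<in> divisors G x"
  shows "z \<in> divisors G x"
proof -
  obtain p q r s where pqrs: "p \<in> carrier G" "q \<in> carrier G" "r \<in> carrier G" "s \<in> carrier G"
    and "z \<in> carrier G" "y = p \<otimes> z \<otimes> q" "x = r \<otimes> y \<otimes> s"
    using assms unfolding mem_divisors_iff by blast
  then have "x = (r \<otimes> p) \<otimes> z \<otimes> (q \<otimes> s)"
    by (simp add: m_assoc)
  with pqrs \<open>z \<in> carrier G\<close> show ?thesis
    unfolding mem_divisors_iff by blast
qed

lemma left_factor_divisor: "\<lbrakk>x \<in> carrier G; y \<in> carrier G\<rbrakk> \<Longrightarrow> x \<in> divisors G (x \<otimes> y)"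
  unfolding mem_divisors_iff by (intro conjI bexI[of _ \<one>] bexI[of _ y]) auto

lemma right_factor_divisor: "\<lbrakk>x \<in> carrier G; y \<in> carrier G\<rbrakk> \<Longrightarrow> y \<in> divisors G (x \<otimes> y)"
  unfolding mem_divisors_iff by (intro conjI bexI[of _ x] bexI[of _ \<one>]) auto

text \<open>Both factors of a product divide it and divisibility is transitive, so every generator
  used in building \<open>x\<close> divides \<open>x\<close>.\<close>

lemma generated_subsemigroup_divisors:
  assumes "x \<in> generated_subsemigroup G X" "X \<subseteq> carrier G"
  shows "x \<in> generated_subsemigroup G {d \<in> X. d \<in> divisors G x}"
  using assms
proof induction
  case (base x)
  then show ?case
    by (auto intro: generated_subsemigroup.base divisors_refl)
next
  case (mult x y)
  then have xy: "x \<in> carrier G" "y \<in> carrier G"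
    by (auto intro: generated_subsemigroup_closed)
  have sub: "generated_subsemigroup G {d \<in> X. d \<in> divisors G z}
      \<subseteq> generated_subsemigroup G {d \<in> X. d \<in> divisors G (x \<otimes> y)}"
    if "z \<in> divisors G (x \<otimes> y)" for z
    using divisors_trans[OF _ that]
    by (intro generated_subsemigroup_least subsetI generated_subsemigroup.base) auto
  from mult sub[OF left_factor_divisor[OF xy]] sub[OF right_factor_divisor[OF xy]] show ?case
    by (auto intro: generated_subsemigroup.mult)
qed

end

section \<open>Units and their multiples in a weakly positive monoid\<close>

context weakly_positive_monoid
begin

lemma le_trans:
  assumes "x \<preceq> y" "y \<preceq> z" "x \<in> carrier H" "y \<in> carrier H" "z \<in> carrier H"
  shows "x \<preceq> z"
  using transp_onD[OF preord_trans] assms by blast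

lemma divisor_le: "y \<in> divisors H x \<Longrightarrow> y \<preceq> x"
  unfolding mem_divisors_iff by (auto intro: le_mult)

lemma pre_units_closed: "u \<in> pre_units H \<Longrightarrow> u \<in> carrier H"
  by (simp add: pre_units_def)

text \<open>The other half, \<open>\<one> \<preceq> u\<close>, is automatic: \<open>\<one>\<close>
  divides everything and divisors lie below.\<close>

lemma pre_units_iff: "u \<in> pre_units H \<longleftrightarrow> u \<in> carrier H \<and> u \<preceq> \<one>"
  using le_mult[of \<one> u \<one>] by (auto simp: pre_units_def)

lemma one_pre_unit: "\<one> \<in> pre_units H"
  using preord_refl by (auto simp: pre_units_iff reflp_on_def)

lemma mult_pre_unit: "\<lbrakk>u \<in> pre_units H; v \<in> pre_units H\<rbrakk> \<Longrightarrow> u \<otimes> v \<in> pre_units H"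
  using units_le[of \<one> u v] by (auto simp: pre_units_iff)

lemma divisor_pre_unit: "\<lbrakk>y \<in> divisors H u; u \<in> pre_units H\<rbrakk> \<Longrightarrow> y \<in> pre_units H"
  using divisor_le[of y u] le_trans[of y u \<one>] by (auto simp: pre_units_iff mem_divisors_iff)

lemma mult_pre_unit_iff:
  "\<lbrakk>x \<in> carrier H; y \<in> carrier H\<rbrakk> \<Longrightarrow> x \<otimes> y \<in> pre_units H \<longleftrightarrow> x \<in> pre_units H \<and> y \<in> pre_units H"
  by (metis divisor_pre_unit left_factor_divisor right_factor_divisor mult_pre_unit)

text \<open>The units are those of \<open>H\<close>. They include the units of every subpremonoid,
  so generators of a germ are covered.\<close>

definition unit_multiples :: "'a set \<Rightarrow> 'a set"
  where "unit_multiples A = pre_units H <#> A <#> pre_units H"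

lemma mem_unit_multiples_iff:
  "s \<in> unit_multiples A \<longleftrightarrow>
    (\<exists>u \<in> pre_units H. \<exists>a \<in> A. \<exists>v \<in> pre_units H. s = u \<otimes> a \<otimes> v)"
  by (auto simp: unit_multiples_def set_mult_def)

lemma unit_multiples_closed: "A \<subseteq> carrier H \<Longrightarrow> unit_multiples A \<subseteq> carrier H"
  by (auto simp: mem_unit_multiples_iff pre_units_closed subset_iff)

text \<open>The unit \<open>w\<close> merges with the outer unit \<open>u\<close> or
  \<open>v\<close>. The result is a non-unit because factors of units are units.\<close>

lemma unit_mult_unit_multiples:
  assumes "A \<subseteq> carrier H" "w \<in> pre_units H" "s \<in> unit_multiples A - pre_units H"
  shows "w \<otimes> s \<in> unit_multiples A - pre_units H" "s \<otimes> w \<in> unit_multiples A - pre_units H"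
proof -
  obtain u a v where uav: "u \<in> pre_units H" "a \<in> A" "v \<in> pre_units H" "s = u \<otimes> a \<otimes> v"
    using assms by (auto simp: mem_unit_multiples_iff)
  have "w \<otimes> s = (w \<otimes> u) \<otimes> a \<otimes> v" "s \<otimes> w = u \<otimes> a \<otimes> (v \<otimes> w)"
    using uav assms by (auto simp: m_assoc pre_units_closed subset_iff)
  then have "w \<otimes> s \<in> unit_multiples A" "s \<otimes> w \<in> unit_multiples A"
    using uav(1-3) mult_pre_unit[OF assms(2) uav(1)] mult_pre_unit[OF uav(3) assms(2)]
    by (auto simp: mem_unit_multiples_iff)
  moreover have "s \<in> carrier H"
    using assms unit_multiples_closed by blast
  ultimately show "w \<otimes> s \<in> unit_multiples A - pre_units H" "s \<otimes> w \<in> unit_multiples A - pre_units H"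
    using assms by (simp_all add: mult_pre_unit_iff pre_units_closed)
qed

text \<open>The first or last factor of the product absorbs the unit.\<close>

lemma unit_mult_generated_subsemigroup:
  assumes "p \<in> generated_subsemigroup H (unit_multiples A - pre_units H)"
    and A: "A \<subseteq> carrier H" and w: "w \<in> pre_units H"
  shows "w \<otimes> p \<in> generated_subsemigroup H (unit_multiples A - pre_units H) \<and>
    p \<otimes> w \<in> generated_subsemigroup H (unit_multiples A - pre_units H)"
  using assms(1)
proof induction
  case (base s)
  then show ?case
    using unit_mult_unit_multiples[OF A w] by (auto intro: generated_subsemigroup.base)
next
  case (mult x y)
  have "unit_multiples A - pre_units H \<subseteq> carrier H"
    using unit_multiples_closed[OF A] by blast
  with mult.hyps have "x \<in> carrier H" "y \<in> carrier H"
    by (auto intro: generated_subsemigroup_closed)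
  then have "w \<otimes> (x \<otimes> y) = (w \<otimes> x) \<otimes> y" "(x \<otimes> y) \<otimes> w = x \<otimes> (y \<otimes> w)"
    using w by (auto simp: m_assoc pre_units_closed)
  with mult show ?case
    by (auto intro: generated_subsemigroup.mult)
qed

text \<open>Only mixed products need an argument, and there the unit is absorbed. Containing all
  unit multiples of \<open>A\<close>, this submonoid bounds whatever they generate.\<close>

lemma submonoid_units_un_generated_subsemigroup:
  assumes "A \<subseteq> carrier H"
  shows "submonoid (pre_units H \<union> generated_subsemigroup H (unit_multiples A - pre_units H)) H"
proof
  show "pre_units H \<union> generated_subsemigroup H (unit_multiples A - pre_units H) \<subseteq> carrier H"
    using unit_multiples_closed[OF assms] pre_units_closed
    by (auto intro: generated_subsemigroup_closed)
next
  fix x y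
  assume "x \<in> pre_units H \<union> generated_subsemigroup H (unit_multiples A - pre_units H)"
    "y \<in> pre_units H \<union> generated_subsemigroup H (unit_multiples A - pre_units H)"
  then show "x \<otimes> y \<in> pre_units H \<union> generated_subsemigroup H (unit_multiples A - pre_units H)"
    using unit_mult_generated_subsemigroup[OF _ assms] mult_pre_unit generated_subsemigroup.mult[of x]
    by (elim UnE) blast+
qed (simp add: one_pre_unit)

lemma fgu_subpremonoid_generators:
  assumes K: "submonoid K H" and fgu: "fgu (subpremonoid H K)"
  obtains A where "A \<subseteq> carrier H" "finite A"
    "K - pre_units H \<subseteq> generated_subsemigroup H (unit_multiples A - pre_units H)"
proof -
  interpret K: submonoid K H by fact
  define V where "V = pre_units (subpremonoid H K)"
  have V: "V \<subseteq> pre_units H" "V \<subseteq> K"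
    using K.subset by (auto simp: V_def pre_units_def subpremonoid_def)
  obtain A where A: "A \<subseteq> K" "finite A"
    and gen: "K = generated_submonoid (subpremonoid H K) (V <#> A <#> V)"
    using fgu unfolding fgu_def V_def by (auto simp: subpremonoid_def set_mult_def)
  have AH: "A \<subseteq> carrier H"
    using A K.subset by blast
  define T where "T = pre_units H \<union> generated_subsemigroup H (unit_multiples A - pre_units H)"
  interpret T: submonoid T H
    unfolding T_def by (rule submonoid_units_un_generated_subsemigroup[OF AH])
  \<comment> \<open>The hull ranges over submonoids of the subpremonoid, so \<open>T\<close> has to
    be cut down to \<open>K\<close> before minimality applies.\<close>
  have "submonoid (T \<inter> K) (subpremonoid H K)"
    by unfold_locales (auto simp: subpremonoid_def)
  moreover have "V <#> A <#> V \<subseteq> T \<inter> K"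
  proof
    fix s assume "s \<in> V <#> A <#> V"
    then obtain u a v where uav: "u \<in> V" "a \<in> A" "v \<in> V" "s = u \<otimes> a \<otimes> v"
      by (auto simp: set_mult_def)
    then have "s \<in> unit_multiples A"
      using V by (auto simp: mem_unit_multiples_iff)
    then have "s \<in> T"
      by (auto simp: T_def intro: generated_subsemigroup.base)
    moreover have "s \<in> K"
      using uav V A by (metis K.m_closed subsetD)
    ultimately show "s \<in> T \<inter> K"
      by blast
  qed
  ultimately have "generated_submonoid (subpremonoid H K) (V <#> A <#> V) \<subseteq> T \<inter> K"
    unfolding generated_submonoid_def by (intro hull_minimal)
  then have "K \<subseteq> T"
    using gen by blast
  then have "K - pre_units H \<subseteq> generated_subsemigroup H (unit_multiples A - pre_units H)"
    by (auto simp: T_def)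
  with AH \<open>finite A\<close> show thesis
    by (rule that)
qed

text \<open>One finite set \<open>A\<close> serves all divisors of \<open>x\<close>, so the
  induction can pass from \<open>y\<close> to factors of its factors.\<close>

lemma divisor_product_of_irreducibles:
  assumes A: "A \<subseteq> carrier H" "finite A"
    and gen: "divisors H x - pre_units H
      \<subseteq> generated_subsemigroup H (unit_multiples A - pre_units H)"
    and y: "y \<in> divisors H x" "y \<notin> pre_units H"
  shows "y \<in> generated_subsemigroup H {a. pre_irreducible H a}"
  using y
proof (induction "card {a \<in> A. a \<preceq> y}" arbitrary: y rule: less_induct)
  case less
  let ?S = "unit_multiples A - pre_units H"
  let ?I = "generated_subsemigroup H {a. pre_irreducible H a}"
  have SH: "?S \<subseteq> carrier H"
    using unit_multiples_closed[OF A(1)] by blast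
  have yH: "y \<in> carrier H"
    using less.prems by (simp add: mem_divisors_iff)
  have "s \<in> ?I" if s: "s \<in> ?S" "s \<in> divisors H y" for s
  proof (cases "pre_irreducible H s")
    case True
    then show ?thesis
      by (auto intro: generated_subsemigroup.base)
  next
    case False
    have sH: "s \<in> carrier H"
      using s SH by blast
    obtain u a v where uav: "u \<in> pre_units H" "a \<in> A" "v \<in> pre_units H" "s = u \<otimes> a \<otimes> v"
      using s by (auto simp: mem_unit_multiples_iff)
    have aH: "a \<in> carrier H"
      using uav A by blast
    \<comment> \<open>The two axioms of weak positivity give one direction each.\<close>
    have "s \<preceq> a" "a \<preceq> s"
      using uav aH units_le le_mult pre_units_closed by auto
    have "s \<preceq> y"
      using s divisor_le by blast
    have I: "r \<in> ?I" if r: "r \<in> divisors H s" "r \<notin> pre_units H" "r \<prec> s" for r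
    proof (rule less.hyps)
      have rH: "r \<in> carrier H"
        using r by (simp add: mem_divisors_iff)
      have "r \<preceq> y"
        using le_trans[of r s y] r \<open>s \<preceq> y\<close> rH sH yH by (simp add: preord_strict_def)
      \<comment> \<open>Otherwise \<open>s \<preceq> a \<preceq> r\<close>, against
        \<open>r \<prec> s\<close>. So \<open>a\<close> is counted for \<open>y\<close> but not for
        \<open>r\<close>.\<close>
      moreover have "\<not> a \<preceq> r"
        using le_trans[OF \<open>s \<preceq> a\<close>] r rH sH aH by (auto simp: preord_strict_def)
      moreover have "a \<preceq> y"
        using le_trans[OF \<open>a \<preceq> s\<close> \<open>s \<preceq> y\<close>] aH sH yH by blast
      ultimately have "{a \<in> A. a \<preceq> r} \<subset> {a \<in> A. a \<preceq> y}"
        using uav(2) A(1) le_trans[OF _ \<open>r \<preceq> y\<close>] rH yH by blast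
      then show "card {a \<in> A. a \<preceq> r} < card {a \<in> A. a \<preceq> y}"
        using A(2) by (intro psubset_card_mono) auto
      show "r \<in> divisors H x"
        using r s less.prems divisors_trans by blast
    qed (use r in blast)
    \<comment> \<open>As \<open>s\<close> is a non-unit, it can only fail to be irreducible through
      such a factorization; \<open>p\<close> and \<open>q\<close> divide \<open>s\<close>, so
      \<open>I\<close> applies to both.\<close>
    obtain p q where "p \<in> carrier H" "q \<in> carrier H" "p \<notin> pre_units H" "q \<notin> pre_units H"
      "p \<prec> s" "q \<prec> s" "s = p \<otimes> q"
      using False s sH by (auto simp: pre_irreducible_def pre_nonunits_def)
    with I left_factor_divisor right_factor_divisor show ?thesis
      by (metis generated_subsemigroup.mult)
  qed
  then have "generated_subsemigroup H {s \<in> ?S. s \<in> divisors H y} \<subseteq> ?I"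
    by (intro generated_subsemigroup_least) auto
  moreover have "y \<in> generated_subsemigroup H {s \<in> ?S. s \<in> divisors H y}"
    using less.prems gen by (intro generated_subsemigroup_divisors[OF _ SH]) auto
  ultimately show ?case
    by blast
qed

end

theorem corollary4p8:
  fixes H :: "('a, 'b) premonoid_scheme"
  assumes "weakly_positive_monoid H"
    and "weakly_lfgu H"
  shows "factorable H"
  unfolding factorable_def
proof
  interpret weakly_positive_monoid H by fact
  fix x assume x: "x \<in> pre_nonunits H"
  let ?K = "generated_submonoid H (divisors H x)"
  have "submonoid ?K H"
    by (rule submonoid_generated_submonoid) (auto simp: divisors_def)
  moreover have "fgu (subpremonoid H ?K)"
    using assms(2) x by (simp add: weakly_lfgu_def germ_def)
  ultimately obtain A where A: "A \<subseteq> carrier H" "finite A"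
    "?K - pre_units H \<subseteq> generated_subsemigroup H (unit_multiples A - pre_units H)"
    by (rule fgu_subpremonoid_generators)
  have "divisors H x \<subseteq> ?K"
    unfolding generated_submonoid_def by (rule hull_subset)
  \<comment> \<open>\<open>x\<close> is a divisor of itself, so the lemma applies with
    \<open>y = x\<close>.\<close>
  with A x have "x \<in> generated_subsemigroup H {a. pre_irreducible H a}"
    by (intro divisor_product_of_irreducibles[of A x]) (auto simp: pre_nonunits_def divisors_refl)
  then have "\<exists>as. set as \<subseteq> {a. pre_irreducible H a} \<and> x = foldr (\<otimes>\<^bsub>H\<^esub>) as \<one>\<^bsub>H\<^esub>"
    by (rule generated_subsemigroup_foldr) (auto simp: pre_irreducible_def pre_nonunits_def)
  then show "\<exists>as. (\<forall>a \<in> set as. pre_irreducible H a) \<and> x = foldr (\<otimes>\<^bsub>H\<^esub>) as \<one>\<^bsub>H\<^esub>"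
    by auto
qed

end
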